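(* Let $A:X\to Y^*$ be a linear operator, $C\subseteq X$, $K\subseteq Y$ closed convex cones, and $c\in X^*$, $b\in Y^*$ such that both programs $$(P):\ \inf_x\ \langle c,x\rangle\ \text{ s.t. } Ax-b\in K^*,\ x\in C;\qquad (D):\ \sup_y\ \langle y,b\rangle\ \text{ s.t. } -A^*y+c\in C^*,\ y\in K$$ are feasible. Consider the game $G=(\alpha,\beta,A)$ for some $\alpha\in\mathrm{int}\,C^*$, $\beta\in\mathrm{int}\,K^*$, with strategy sets $S=\{x\in C:\langle\alpha,x\rangle=1\}$ and $T=\{y\in K:\langle y,\beta\rangle=1\}$, and let $v$ be its value. If $v=0$, then the following equivalences hold: (1) $(P)$ is strictly feasible if and only if for every $y\in T$ with $-A^*y\in C^*$ one has $\langle y,b\rangle<0$; (2) $(D)$ is strictly feasible if and only if for every $x\in S$ with $Ax\in K^*$ one has $\langle c,x\rangle>0$.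
   Context: $X$ and $Y$ are real reflexive Banach spaces with continuous duals $X^*$, $Y^*$; $\langle w,x\rangle$ ($w\in X^*,x\in X$) and $\langle y,z\rangle$ ($y\in Y,z\in Y^*$) are the canonical pairings; all spaces carry their norm topologies. A convex cone is a set $C$ with $\lambda C\subseteq C$ for all $\lambda\ge0$ and $\kappa C+(1-\kappa)C\subseteq C$ for all $\kappa\in[0,1]$. $C^*=\{w\in X^*:\langle w,x\rangle\ge0\ \forall x\in C\}$, $K^*=\{z\in Y^*:\langle y,z\rangle\ge0\ \forall y\in K\}$; both are assumed to have non-empty interior. The linear operator $A$ is assumed to have an adjoint: for every $y\in Y$ there is a unique $A^*y\in X^*$ with $\langle A^*y,x\rangle=\langle y,Ax\rangle$ for all $x\in X$. A program is feasible if its feasible set is non-empty. $(P)$ is strictly feasible if there is $x\in C$ with $Ax-b\in\mathrm{int}\,K^*$; $(D)$ is strictly feasible if there is $y\in K$ with $-A^*y+c\in\mathrm{int}\,C^*$. In the game $G=(\alpha,\beta,A)$ the payoff is $u(x,y)=\langle y,Ax\rangle$, maximized by player I over $S$ and minimized by player II over $T$; $S,T$ are non-empty and the lower and upper values are finite. The value is $v=\sup_{x\in S}\inf_{y\in T}u(x,y)=\inf_{y\in T}\sup_{x\in S}u(x,y)$ (it exists in this setting). *)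

theory Defs
  imports "HOL-Analysis.Analysis"
begin

type_synonym 'a dual = "'a \<Rightarrow>\<^sub>L real"

definition reflexive_space :: "'a::real_normed_vector itself \<Rightarrow> bool" where
  "reflexive_space _ \<longleftrightarrow>
     (\<forall>\<phi> :: 'a dual \<Rightarrow>\<^sub>L real. \<exists>x :: 'a. \<forall>w :: 'a dual.
        blinfun_apply \<phi> w = blinfun_apply w x)"

definition dual_cone :: "'a::real_normed_vector set \<Rightarrow> 'a dual set" where
  "dual_cone C = {w. \<forall>x\<in>C. 0 \<le> blinfun_apply w x}"

text \<open>The operator goes from a space into the dual of another one, so its adjoint is taken
  with respect to the canonical pairings; the library's \<^verbatim>\<open>adjoint\<close> is the inner-product one.\<close>

definition has_dual_adjoint ::
    "('a::real_normed_vector \<Rightarrow> 'b::real_normed_vector dual) \<Rightarrow> bool" where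
  "has_dual_adjoint A \<longleftrightarrow>
     (\<forall>y. \<exists>!w :: 'a dual. \<forall>x. blinfun_apply w x = blinfun_apply (A x) y)"

definition dual_adjoint ::
    "('a::real_normed_vector \<Rightarrow> 'b::real_normed_vector dual) \<Rightarrow> 'b \<Rightarrow> 'a dual" where
  "dual_adjoint A y = (THE w. \<forall>x. blinfun_apply w x = blinfun_apply (A x) y)"

definition primal_feasible_set ::
    "('a::real_normed_vector \<Rightarrow> 'b::real_normed_vector dual) \<Rightarrow> 'b dual \<Rightarrow> 'a set \<Rightarrow> 'b set \<Rightarrow> 'a set"
  where "primal_feasible_set A b C K = {x \<in> C. A x - b \<in> dual_cone K}"

definition dual_feasible_set ::
    "('a::real_normed_vector \<Rightarrow> 'b::real_normed_vector dual) \<Rightarrow> 'a dual \<Rightarrow> 'a set \<Rightarrow> 'b set \<Rightarrow> 'b set"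
  where "dual_feasible_set A c C K = {y \<in> K. - dual_adjoint A y + c \<in> dual_cone C}"

definition primal_strictly_feasible ::
    "('a::real_normed_vector \<Rightarrow> 'b::real_normed_vector dual) \<Rightarrow> 'b dual \<Rightarrow> 'a set \<Rightarrow> 'b set \<Rightarrow> bool"
  where "primal_strictly_feasible A b C K \<longleftrightarrow> (\<exists>x\<in>C. A x - b \<in> interior (dual_cone K))"

definition dual_strictly_feasible ::
    "('a::real_normed_vector \<Rightarrow> 'b::real_normed_vector dual) \<Rightarrow> 'a dual \<Rightarrow> 'a set \<Rightarrow> 'b set \<Rightarrow> bool"
  where "dual_strictly_feasible A c C K \<longleftrightarrow>
    (\<exists>y\<in>K. - dual_adjoint A y + c \<in> interior (dual_cone C))"

definition strategy_set :: "'a::real_normed_vector dual \<Rightarrow> 'a set \<Rightarrow> 'a set" where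
  "strategy_set \<gamma> C = {x \<in> C. blinfun_apply \<gamma> x = 1}"

text \<open>Suprema and infima are taken in the extended reals, where they always exist, because on
  \<^typ>\<open>real\<close> they are unspecified for unbounded sets.\<close>

definition lower_value :: "('a \<Rightarrow> 'b \<Rightarrow> real) \<Rightarrow> 'a set \<Rightarrow> 'b set \<Rightarrow> ereal" where
  "lower_value u S T = (SUP x\<in>S. INF y\<in>T. ereal (u x y))"

definition upper_value :: "('a \<Rightarrow> 'b \<Rightarrow> real) \<Rightarrow> 'a set \<Rightarrow> 'b set \<Rightarrow> ereal" where
  "upper_value u S T = (INF y\<in>T. SUP x\<in>S. ereal (u x y))"

definition admissible_game :: "('a \<Rightarrow> 'b \<Rightarrow> real) \<Rightarrow> 'a set \<Rightarrow> 'b set \<Rightarrow> bool" where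
  "admissible_game u S T \<longleftrightarrow> S \<noteq> {} \<and> T \<noteq> {} \<and>
     \<bar>lower_value u S T\<bar> \<noteq> \<infinity> \<and> \<bar>upper_value u S T\<bar> \<noteq> \<infinity>"

definition is_game_value :: "('a \<Rightarrow> 'b \<Rightarrow> real) \<Rightarrow> 'a set \<Rightarrow> 'b set \<Rightarrow> real \<Rightarrow> bool" where
  "is_game_value u S T v \<longleftrightarrow> ereal v = lower_value u S T \<and> ereal v = upper_value u S T"

end

theory Submission
  imports Defs
begin

text \<open>
  Both equivalences are instances of one theorem of the alternative: for a linear map
  \<open>A\<close> into the dual of a reflexive space, a convex cone \<open>C\<close>, a closed convex cone \<open>K\<close> and
  \<open>\<beta>\<close> in the interior of the dual cone \<open>K\<^sup>*\<close>, the system \<open>x \<in> C\<close>, \<open>A x - b \<in> int K\<^sup>*\<close> is solvable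
  iff \<open>\<langle>y, b\<rangle> < 0\<close> for every \<open>y \<in> K\<close> with \<open>\<langle>y, \<beta>\<rangle> = 1\<close> and \<open>\<langle>y, A x\<rangle> \<le> 0\<close> on \<open>C\<close>
  (\<open>strict_feasibility_alternative\<close>).  Part (1) is this statement for \<open>A\<close>, \<open>b\<close>; part (2) is
  the same statement for \<open>- A\<^sup>*\<close>, \<open>- c\<close>, with the roles of the two spaces exchanged.

  Necessity holds because an element of \<open>int K\<^sup>*\<close> is strictly positive at such a \<open>y\<close>.  For
  sufficiency, suppose the system is not solvable, and let
  \<open>D = {A x - k - s b | x \<in> C, k \<in> K\<^sup>*, s \<ge> 0}\<close>.
  If \<open>\<beta>\<close> were in the closure of this convex cone, then some \<open>A x - s b\<close> would lie in
  \<open>K\<^sup>* + int K\<^sup>*\<close>, hence in \<open>int K\<^sup>*\<close>; as \<open>int K\<^sup>*\<close> is open one may take \<open>s > 0\<close>, and \<open>x / s\<close>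
  solves the system.  So a continuous functional on the dual separates \<open>\<beta>\<close> from \<open>D\<close>.  By
  reflexivity it is the evaluation at some \<open>y\<close>.  The three parts of \<open>D\<close> give \<open>\<langle>y, A x\<rangle> \<le> 0\<close>,
  \<open>y \<in> K\<^sup>*\<^sup>* = K\<close> and \<open>\<langle>y, b\<rangle> \<ge> 0\<close>, while \<open>\<langle>y, \<beta>\<rangle> > 0\<close> permits normalisation.

  The separation of a point from the closure of a convex cone is the Hahn-Banach theorem for
  the distance to the cone, which is a sublinear functional.  Hahn-Banach itself is obtained
  without extending functionals from subspaces: by Zorn's lemma every sublinear functional
  dominates a minimal one, and minimal sublinear functionals are linear.
\<close>

section \<open>Sublinear functionals and the Hahn-Banach theorem\<close>

text \<open>Sublinear functionals: subadditive and positively homogeneous real functions on a real vector space;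
  homogeneity includes the factor \<open>0\<close>.\<close>

definition sublinear :: "('a::real_vector \<Rightarrow> real) \<Rightarrow> bool" where
  "sublinear p \<longleftrightarrow> (\<forall>x y. p (x + y) \<le> p x + p y) \<and> (\<forall>t x. 0 \<le> t \<longrightarrow> p (t *\<^sub>R x) = t * p x)"

lemma sublinear_add: "sublinear p \<Longrightarrow> p (x + y) \<le> p x + p y"
  by (simp add: sublinear_def)

lemma sublinear_scale: "sublinear p \<Longrightarrow> 0 \<le> t \<Longrightarrow> p (t *\<^sub>R x) = t * p x"
  by (simp add: sublinear_def)

lemma sublinear_zero: "sublinear p \<Longrightarrow> p 0 = 0"
  using sublinear_scale[of p 0 0] by simp

lemma sublinear_neg: "sublinear p \<Longrightarrow> - p (- x) \<le> p x"
  using sublinear_add[of p x "- x"] sublinear_zero[of p] by simp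

lemma sublinearI:
  assumes add: "\<And>x y. p (x + y) \<le> p x + p y"
    and zero: "p 0 = 0"
    and scale: "\<And>t x. 0 < t \<Longrightarrow> p (t *\<^sub>R x) \<le> t * p x"
  shows "sublinear p"
proof -
  have "p (t *\<^sub>R x) = t * p x" if "0 \<le> t" for t x
  proof (cases "t = 0")
    case False
    with that have t: "0 < t" by simp
    \<comment> \<open>The reverse inequality is the scaling bound for \<open>1 / t\<close>.\<close>
    have "p ((1 / t) *\<^sub>R (t *\<^sub>R x)) \<le> (1 / t) * p (t *\<^sub>R x)"
      using t by (intro scale) simp
    with t have "t * p x \<le> p (t *\<^sub>R x)" by (simp add: field_simps)
    with scale[OF t, of x] show ?thesis by simp
  qed (simp add: zero)
  with add show ?thesis by (simp add: sublinear_def)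
qed

text \<open>A sublinear functional can be decreased so that it becomes additive in a given direction
  \<open>y\<close>: the resulting functional takes the value \<open>- q y\<close>, the least possible one, at \<open>- y\<close>.\<close>

lemma sublinear_lowering:
  assumes q: "sublinear q"
  obtains r where "sublinear r" "r \<le> q" "\<And>x. r x \<le> q (x + y) - q y"
proof -
  define r where "r x = (INF t\<in>{0..}. q (x + t *\<^sub>R y) - t * q y)" for x
  have lower: "- q (- x) \<le> q (x + t *\<^sub>R y) - t * q y" if "0 \<le> t" for x t
    using sublinear_add[OF q, of "x + t *\<^sub>R y" "- x"] sublinear_scale[OF q that, of y] by simp
  have bdd: "bdd_below ((\<lambda>t. q (x + t *\<^sub>R y) - t * q y) ` {0..})" for x
    by (rule bdd_belowI2[of _ "- q (- x)"]) (use lower in auto)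
  have r_le: "r x \<le> q (x + t *\<^sub>R y) - t * q y" if "0 \<le> t" for x t
    unfolding r_def by (rule cINF_lower[OF bdd]) (use that in simp)
  have r_ge: "m \<le> r x" if "\<And>t. 0 \<le> t \<Longrightarrow> m \<le> q (x + t *\<^sub>R y) - t * q y" for m x
    unfolding r_def by (rule cINF_greatest) (use that in auto)
  have "sublinear r"
  proof (rule sublinearI)
    fix x x'
    have "r (x + x') - (q (x' + s *\<^sub>R y) - s * q y) \<le> r x" if s: "0 \<le> s" for s
    proof (rule r_ge)
      fix t :: real
      assume t: "0 \<le> t"
      have "r (x + x') \<le> q ((x + t *\<^sub>R y) + (x' + s *\<^sub>R y)) - (t + s) * q y"
        using r_le[of "t + s" "x + x'"] s t by (simp add: algebra_simps)
      also have "\<dots> \<le> q (x + t *\<^sub>R y) + q (x' + s *\<^sub>R y) - (t + s) * q y"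
        using sublinear_add[OF q] by simp
      finally show "r (x + x') - (q (x' + s *\<^sub>R y) - s * q y) \<le> q (x + t *\<^sub>R y) - t * q y"
        by (simp add: algebra_simps)
    qed
    then have "r (x + x') - r x \<le> r x'"
      by (intro r_ge) (smt (verit))
    then show "r (x + x') \<le> r x + r x'" by simp
  next
    have "r 0 \<le> 0"
      using r_le[of 0 0] sublinear_zero[OF q] by simp
    moreover have "0 \<le> r 0"
      by (rule r_ge) (simp add: sublinear_scale[OF q])
    ultimately show "r 0 = 0" by simp
  next
    fix t :: real and x
    assume t: "0 < t"
    have "r (t *\<^sub>R x) / t \<le> r x"
    proof (rule r_ge)
      fix s :: real
      assume s: "0 \<le> s"
      have "r (t *\<^sub>R x) \<le> q (t *\<^sub>R (x + s *\<^sub>R y)) - (t * s) * q y"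
        using r_le[of "t * s" "t *\<^sub>R x"] s t by (simp add: algebra_simps)
      also have "\<dots> = t * (q (x + s *\<^sub>R y) - s * q y)"
        using sublinear_scale[OF q, of t "x + s *\<^sub>R y"] t by (simp add: right_diff_distrib)
      finally show "r (t *\<^sub>R x) / t \<le> q (x + s *\<^sub>R y) - s * q y"
        using t by (simp add: field_simps)
    qed
    with t show "r (t *\<^sub>R x) \<le> t * r x" by (simp add: field_simps)
  qed
  moreover have "r \<le> q"
    using r_le[of 0] by (simp add: le_fun_def)
  moreover have "r x \<le> q (x + y) - q y" for x
    using r_le[of 1 x] by simp
  ultimately show thesis by (rule that)
qed

text \<open>Minimality means that the lowering of \<open>q\<close> in any direction \<open>y\<close> is \<open>q\<close> itself, which gives the
  superadditivity \<open>q x + q y \<le> q (x + y)\<close>.\<close>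

lemma minimal_sublinear_imp_linear:
  assumes q: "sublinear q" and minimal: "\<And>r. sublinear r \<Longrightarrow> r \<le> q \<Longrightarrow> r = q"
  shows "linear q"
proof (rule linearI)
  show add: "q (x + y) = q x + q y" for x y
  proof -
    obtain r where r: "sublinear r" "r \<le> q" "\<And>x. r x \<le> q (x + y) - q y"
      using sublinear_lowering[OF q, of y] by blast
    then have "r = q" by (intro minimal)
    with r(3)[of x] sublinear_add[OF q, of x y] show ?thesis by simp
  qed
  have neg: "q (- x) = - q x" for x
    using add[of x "- x"] sublinear_zero[OF q] by simp
  show "q (t *\<^sub>R x) = t *\<^sub>R q x" for t x
  proof (cases "0 \<le> t")
    case False
    then have "q (- (t *\<^sub>R x)) = (- t) * q x"
      using sublinear_scale[OF q, of "- t" x] by simp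
    then show ?thesis by (simp add: neg)
  qed (simp add: sublinear_scale[OF q])
qed

text \<open>The upper bound \<open>p\<close> also bounds the chain from below, since \<open>q x \<ge> - q (- x) \<ge> - p (- x)\<close>;
  so the pointwise infimum is finite.\<close>

lemma sublinear_INF_chain:
  assumes "Q \<noteq> {}" and sub: "\<And>q. q \<in> Q \<Longrightarrow> sublinear q" and below: "\<And>q. q \<in> Q \<Longrightarrow> q \<le> p"
    and chain: "\<And>q q'. q \<in> Q \<Longrightarrow> q' \<in> Q \<Longrightarrow> q \<le> q' \<or> q' \<le> q"
  obtains r where "sublinear r" "\<And>q. q \<in> Q \<Longrightarrow> r \<le> q"
proof -
  define r where "r x = (INF q\<in>Q. q x)" for x
  have "- p (- x) \<le> q x" if "q \<in> Q" for q x
    using sublinear_neg[OF sub[OF that], of x] le_funD[OF below[OF that], of "- x"] by simp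
  then have bdd: "bdd_below ((\<lambda>q. q x) ` Q)" for x
    by (intro bdd_belowI2[of _ "- p (- x)"])
  have r_le: "r x \<le> q x" if "q \<in> Q" for q x
    unfolding r_def by (rule cINF_lower[OF bdd that])
  have r_ge: "m \<le> r x" if "\<And>q. q \<in> Q \<Longrightarrow> m \<le> q x" for m x
    unfolding r_def by (rule cINF_greatest[OF \<open>Q \<noteq> {}\<close> that])
  have "sublinear r"
  proof (rule sublinearI)
    fix x y
    have "r (x + y) \<le> q x + q' y" if qq': "q \<in> Q" "q' \<in> Q" for q q'
    proof -
      \<comment> \<open>The smaller of the two functionals bounds the left-hand side.\<close>
      obtain m where m: "m \<in> Q" "m \<le> q" "m \<le> q'"
        using chain[OF qq'] qq' by blast
      show ?thesis
        using r_le[OF m(1), of "x + y"] sublinear_add[OF sub[OF m(1)], of x y]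
          le_funD[OF m(2), of x] le_funD[OF m(3), of y] by simp
    qed
    then have "r (x + y) - q' y \<le> r x" if "q' \<in> Q" for q'
      using that by (intro r_ge) (simp add: algebra_simps)
    then have "r (x + y) - r x \<le> r y"
      by (intro r_ge) (simp add: algebra_simps)
    then show "r (x + y) \<le> r x + r y" by simp
  next
    show "r 0 = 0"
      using \<open>Q \<noteq> {}\<close> sub by (simp add: r_def sublinear_zero)
  next
    fix t :: real and x
    assume t: "0 < t"
    have "r (t *\<^sub>R x) / t \<le> r x"
    proof (rule r_ge)
      fix q
      assume "q \<in> Q"
      with r_le[OF this, of "t *\<^sub>R x"] t show "r (t *\<^sub>R x) / t \<le> q x"
        by (simp add: sublinear_scale[OF sub] field_simps)
    qed
    with t show "r (t *\<^sub>R x) \<le> t * r x" by (simp add: field_simps)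
  qed
  moreover have "r \<le> q" if "q \<in> Q" for q
    using r_le[OF that] by (simp add: le_fun_def)
  ultimately show thesis by (rule that)
qed

lemma exists_linear_below_sublinear:
  assumes p: "sublinear p"
  obtains f where "linear f" "f \<le> p"
proof -
  define P where "P = {q. sublinear q \<and> q \<le> p}"
  let ?ge = "\<lambda>q r :: 'a \<Rightarrow> real. r \<le> q"
  have "\<exists>m\<in>P. \<forall>q\<in>P. q \<le> m \<longrightarrow> q = m"
  proof (rule predicate_Zorn)
    show "partial_order_on P (relation_of ?ge P)"
      by (rule partial_order_on_relation_ofI) auto
  next
    fix Q
    assume Q: "Q \<in> Chains (relation_of ?ge P)"
    then have QP: "Q \<subseteq> P" by (rule Chains_relation_of)
    show "\<exists>r\<in>P. \<forall>q\<in>Q. r \<le> q"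
    proof (cases "Q = {}")
      case True
      with p show ?thesis by (auto simp: P_def)
    next
      case False
      have chain: "q \<le> q' \<or> q' \<le> q" if "q \<in> Q" "q' \<in> Q" for q q'
        using Q that unfolding Chains_def relation_of_def by blast
      obtain r where r: "sublinear r" "\<And>q. q \<in> Q \<Longrightarrow> r \<le> q"
        using sublinear_INF_chain[OF False _ _ chain, of p] QP unfolding P_def by blast
      obtain q where "q \<in> Q" using False by blast
      with r(2) QP have "r \<le> p" unfolding P_def by (blast intro: order_trans)
      with r show ?thesis unfolding P_def by blast
    qed
  qed
  then obtain m where m: "sublinear m" "m \<le> p" and min: "\<And>q. q \<in> P \<Longrightarrow> q \<le> m \<Longrightarrow> q = m"
    unfolding P_def by blast
  have "linear m"
    using m min by (intro minimal_sublinear_imp_linear) (auto simp: P_def)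
  with m(2) show thesis by (rule that[rotated -1])
qed

text \<open>Lowering \<open>p\<close> in the direction \<open>y\<close> first forces equality at \<open>y\<close>.\<close>

theorem sublinear_Hahn_Banach:
  assumes p: "sublinear p"
  obtains f where "linear f" "f \<le> p" "f y = p y"
proof -
  obtain r where r: "sublinear r" "r \<le> p" "\<And>x. r x \<le> p (x + y) - p y"
    using sublinear_lowering[OF p, of y] by blast
  obtain f where f: "linear f" "f \<le> r"
    using exists_linear_below_sublinear[OF r(1)] by blast
  have "f (- y) \<le> - p y"
    using le_funD[OF f(2), of "- y"] r(3)[of "- y"] sublinear_zero[OF p] by simp
  then have "p y \<le> f y"
    by (simp add: linear_neg[OF f(1)])
  moreover have "f \<le> p" using f(2) r(2) by (rule order_trans)
  ultimately show thesis
    using f(1) by (intro that[of f]) (auto simp: le_fun_def intro: antisym)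
qed

section \<open>Separation from convex cones\<close>

lemma infdist_less_obtain:
  assumes "D \<noteq> {}" "infdist x D < m"
  obtains d where "d \<in> D" "dist x d < m"
proof -
  have "\<exists>d\<in>D. dist x d < m"
  proof (rule ccontr)
    assume "\<not> (\<exists>d\<in>D. dist x d < m)"
    then have "m \<le> infdist x D"
      unfolding infdist_notempty[OF assms(1)] using assms(1)
      by (intro cINF_greatest) (auto simp: not_less)
    with assms(2) show False by simp
  qed
  then show thesis using that by blast
qed

lemma sublinear_infdist_convex_cone:
  fixes D :: "'a::real_normed_vector set"
  assumes D: "convex_cone D"
  shows "sublinear (\<lambda>x. infdist x D)"
proof (rule sublinearI)
  have ne: "D \<noteq> {}" using D by (rule convex_cone_nonempty)
  show "infdist 0 D = 0"
    using convex_cone_contains_0[OF D] by simp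
  fix x y :: 'a
  show "infdist (x + y) D \<le> infdist x D + infdist y D"
  proof (rule field_le_epsilon)
    fix e :: real
    assume e: "0 < e"
    obtain d where d: "d \<in> D" "dist x d < infdist x D + e / 2"
      using infdist_less_obtain[OF ne, of x "infdist x D + e / 2"] e by auto
    obtain d' where d': "d' \<in> D" "dist y d' < infdist y D + e / 2"
      using infdist_less_obtain[OF ne, of y "infdist y D + e / 2"] e by auto
    have "infdist (x + y) D \<le> dist (x + y) (d + d')"
      using d(1) d'(1) by (intro infdist_le convex_cone_add[OF D])
    also have "\<dots> \<le> dist x d + dist y d'" by (rule dist_triangle_add)
    finally show "infdist (x + y) D \<le> infdist x D + infdist y D + e"
      using d(2) d'(2) by simp
  qed
  fix t :: real
  assume t: "0 < t"
  have "infdist (t *\<^sub>R x) D / t \<le> infdist x D"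
    unfolding infdist_notempty[OF ne, of x]
  proof (rule cINF_greatest[OF ne])
    fix d
    assume "d \<in> D"
    then have "infdist (t *\<^sub>R x) D \<le> dist (t *\<^sub>R x) (t *\<^sub>R d)"
      using t by (intro infdist_le convex_cone_scaleR[OF D]) auto
    also have "\<dots> = t * dist x d"
      using t by (simp add: dist_norm flip: scaleR_diff_right)
    finally show "infdist (t *\<^sub>R x) D / t \<le> dist x d"
      using t by (simp add: field_simps)
  qed
  with t show "infdist (t *\<^sub>R x) D \<le> t * infdist x D"
    by (simp add: field_simps)
qed

theorem separate_point_convex_cone:
  fixes D :: "'a::real_normed_vector set"
  assumes D: "convex_cone D" and z: "z \<notin> closure D"
  obtains w :: "'a dual" where "0 < blinfun_apply w z" "\<And>d. d \<in> D \<Longrightarrow> blinfun_apply w d \<le> 0"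
proof -
  obtain f where f: "linear f" "f \<le> (\<lambda>x. infdist x D)" "f z = infdist z D"
    using sublinear_Hahn_Banach[OF sublinear_infdist_convex_cone[OF D]] by blast
  have f_le: "f x \<le> norm x" for x
    using le_funD[OF f(2), of x] infdist_le[OF convex_cone_contains_0[OF D], of x] by simp
  have "norm (f x) \<le> norm x * 1" for x
    using f_le[of x] f_le[of "- x"] by (simp add: linear_neg[OF f(1)] abs_le_iff)
  then have "bounded_linear f"
    by (intro bounded_linear_intro[of _ 1]) (auto simp: linear_add[OF f(1)] linear_scale[OF f(1)])
  then have w: "blinfun_apply (Blinfun f) = f"
    by (rule bounded_linear_Blinfun_apply)
  have "infdist z D \<noteq> 0"
    using z in_closure_iff_infdist_zero[OF convex_cone_nonempty[OF D]] by blast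
  then have "0 < f z"
    using infdist_nonneg[of z D] f(3) by simp
  moreover have "f d \<le> 0" if "d \<in> D" for d
    using le_funD[OF f(2), of d] that by simp
  ultimately show thesis
    by (intro that[of "Blinfun f"]) (simp_all add: w)
qed

section \<open>Dual cones\<close>

lemma convex_cone_dual_cone: "convex_cone (dual_cone C)"
  by (auto simp: convex_cone_iff dual_cone_def blinfun.bilinear_simps)

lemma bipolar_dual_cone:
  fixes K :: "'a::real_normed_vector set"
  assumes "convex_cone K" "closed K" and y: "\<And>w. w \<in> dual_cone K \<Longrightarrow> 0 \<le> blinfun_apply w y"
  shows "y \<in> K"
proof (rule ccontr)
  assume "y \<notin> K"
  then obtain w :: "'a dual" where w: "0 < blinfun_apply w y" "\<And>d. d \<in> K \<Longrightarrow> blinfun_apply w d \<le> 0"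
    using separate_point_convex_cone[OF assms(1), of y] closure_closed[OF assms(2)] by blast
  have "- w \<in> dual_cone K"
    using w(2) by (auto simp: dual_cone_def blinfun.bilinear_simps)
  from y[OF this] w(1) show False by (simp add: blinfun.bilinear_simps)
qed

lemma convex_cone_add_interior:
  fixes P :: "'a::real_normed_vector set"
  assumes "convex_cone P" "k \<in> P" "w \<in> interior P"
  shows "k + w \<in> interior P"
proof -
  have "(+) k ` interior P \<subseteq> interior P"
    using assms(1,2) interior_subset[of P]
    by (intro interior_maximal open_translation open_interior) (auto intro: convex_cone_add)
  with assms(3) show ?thesis by blast
qed

lemma convex_cone_scaleR_interior:
  fixes P :: "'a::real_normed_vector set"
  assumes "convex_cone P" "0 < t" "w \<in> interior P"
  shows "t *\<^sub>R w \<in> interior P"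
proof -
  have "(*\<^sub>R) t ` interior P \<subseteq> interior P"
    using assms(1,2) interior_subset[of P]
    by (intro interior_maximal open_scaling open_interior) (auto intro: convex_cone_scaleR)
  with assms(3) show ?thesis by blast
qed

lemma interior_minus_small:
  fixes w d :: "'a::real_normed_vector"
  assumes "w \<in> interior P"
  obtains e where "0 < e" "w - e *\<^sub>R d \<in> interior P"
proof -
  have "((\<lambda>e. w - e *\<^sub>R d) \<longlongrightarrow> w - 0 *\<^sub>R d) (at_right 0)"
    by (intro tendsto_intros)
  then have "eventually (\<lambda>e. w - e *\<^sub>R d \<in> interior P) (at_right 0)"
    using assms by (intro topological_tendstoD[OF _ open_interior]) auto
  then have "eventually (\<lambda>e. 0 < e \<and> w - e *\<^sub>R d \<in> interior P) (at_right 0)"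
    using eventually_at_right_less by (rule eventually_elim2) simp
  from eventually_happens[OF this] that show thesis by auto
qed

text \<open>For small \<open>e > 0\<close> the functional \<open>w - e \<beta>\<close> is still in the dual cone, so
  \<open>\<langle>w, y\<rangle> \<ge> e \<langle>\<beta>, y\<rangle> > 0\<close>.\<close>

lemma interior_dual_cone_strict_pos:
  fixes w \<beta> :: "'a::real_normed_vector dual"
  assumes "w \<in> interior (dual_cone K)" "y \<in> K" "0 < blinfun_apply \<beta> y"
  shows "0 < blinfun_apply w y"
proof -
  obtain e where e: "0 < e" "w - e *\<^sub>R \<beta> \<in> interior (dual_cone K)"
    using interior_minus_small[OF assms(1)] by blast
  then have "0 \<le> blinfun_apply (w - e *\<^sub>R \<beta>) y"
    using interior_subset assms(2) unfolding dual_cone_def by blast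
  moreover have "0 < e * blinfun_apply \<beta> y" using e(1) assms(3) by simp
  ultimately show ?thesis by (simp add: blinfun.bilinear_simps)
qed

section \<open>The theorem of the alternative\<close>

theorem strict_feasibility_alternative:
  fixes A :: "'a::real_vector \<Rightarrow> 'b::real_normed_vector dual"
  assumes refl: "reflexive_space TYPE('b)" and A: "linear A"
    and C: "convex_cone C" and K: "convex_cone K" "closed K"
    and \<beta>: "\<beta> \<in> interior (dual_cone K)"
  shows "(\<exists>x\<in>C. A x - b \<in> interior (dual_cone K)) \<longleftrightarrow>
    (\<forall>y\<in>strategy_set \<beta> K. (\<forall>x\<in>C. blinfun_apply (A x) y \<le> 0) \<longrightarrow> blinfun_apply b y < 0)"
    (is "?strict \<longleftrightarrow> ?alt")
proof
  assume ?strict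
  then obtain x where x: "x \<in> C" "A x - b \<in> interior (dual_cone K)" by blast
  show ?alt
  proof (intro ballI impI)
    fix y
    assume "y \<in> strategy_set \<beta> K" "\<forall>x\<in>C. blinfun_apply (A x) y \<le> 0"
    with x(1) have y: "y \<in> K" "blinfun_apply \<beta> y = 1" "blinfun_apply (A x) y \<le> 0"
      by (auto simp: strategy_set_def)
    with interior_dual_cone_strict_pos[OF x(2) y(1), of \<beta>]
    show "blinfun_apply b y < 0" by (simp add: blinfun.bilinear_simps)
  qed
next
  assume alt: ?alt
  define P where "P = dual_cone K"
  have P: "convex_cone P" unfolding P_def by (rule convex_cone_dual_cone)
  define D where "D = {A x - k - s *\<^sub>R b | x k s. x \<in> C \<and> k \<in> P \<and> 0 \<le> s}"
  have D_mem: "A x - k - s *\<^sub>R b \<in> D" if "x \<in> C" "k \<in> P" "0 \<le> s" for x k s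
    using that unfolding D_def by blast
  have "convex_cone D"
    unfolding convex_cone_iff
  proof (intro conjI ballI allI impI)
    show "0 \<in> D"
      using D_mem[OF convex_cone_contains_0[OF C] convex_cone_contains_0[OF P], of 0]
      by (simp add: linear_0[OF A])
  next
    fix d d'
    assume "d \<in> D" "d' \<in> D"
    then obtain x k s x' k' s' where
      d: "d = A x - k - s *\<^sub>R b" "x \<in> C" "k \<in> P" "0 \<le> s" and
      d': "d' = A x' - k' - s' *\<^sub>R b" "x' \<in> C" "k' \<in> P" "0 \<le> s'"
      unfolding D_def by blast
    have "A (x + x') - (k + k') - (s + s') *\<^sub>R b \<in> D"
      using d d' by (intro D_mem convex_cone_add[OF C] convex_cone_add[OF P]) auto
    then show "d + d' \<in> D"
      by (simp add: d(1) d'(1) linear_add[OF A] algebra_simps)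
  next
    fix d and t :: real
    assume "d \<in> D" and t: "0 \<le> t"
    then obtain x k s where d: "d = A x - k - s *\<^sub>R b" "x \<in> C" "k \<in> P" "0 \<le> s"
      unfolding D_def by blast
    have "A (t *\<^sub>R x) - t *\<^sub>R k - (t * s) *\<^sub>R b \<in> D"
      using d t by (intro D_mem convex_cone_scaleR[OF C] convex_cone_scaleR[OF P]) auto
    then show "t *\<^sub>R d \<in> D"
      by (simp add: d(1) linear_scale[OF A] algebra_simps)
  qed
  show ?strict
  proof (rule ccontr)
    assume not_strict: "\<not> ?strict"
    have "\<beta> \<notin> closure D"
    proof
      assume "\<beta> \<in> closure D"
      moreover obtain r where r: "0 < r" "ball \<beta> r \<subseteq> interior P"
        using openE[OF open_interior \<beta>] unfolding P_def by blast
      ultimately obtain d where d: "d \<in> D" "dist d \<beta> < r"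
        by (meson closure_approachable)
      then obtain x k s where x: "d = A x - k - s *\<^sub>R b" "x \<in> C" "k \<in> P" "0 \<le> s"
        unfolding D_def by blast
      have "d \<in> interior P"
        using d(2) r(2) by (auto simp: dist_commute)
      from convex_cone_add_interior[OF P x(3) this]
      have "A x - s *\<^sub>R b \<in> interior P" by (simp add: x(1))
      \<comment> \<open>The coefficient \<open>s\<close> may be zero, so it is increased by a small amount.\<close>
      then obtain e where e: "0 < e" "A x - s *\<^sub>R b - e *\<^sub>R b \<in> interior P"
        by (rule interior_minus_small)
      have se: "0 < s + e" using x(4) e(1) by simp
      have "(1 / (s + e)) *\<^sub>R (A x - s *\<^sub>R b - e *\<^sub>R b)
          = (1 / (s + e)) *\<^sub>R (A x - (s + e) *\<^sub>R b)"
        by (simp add: scaleR_left_distrib)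
      also have "\<dots> = A ((1 / (s + e)) *\<^sub>R x) - b"
        using se by (simp add: linear_scale[OF A] scaleR_diff_right)
      finally have "A ((1 / (s + e)) *\<^sub>R x) - b \<in> interior P"
        using convex_cone_scaleR_interior[OF P _ e(2), of "1 / (s + e)"] se by simp
      moreover have "(1 / (s + e)) *\<^sub>R x \<in> C"
        using se by (intro convex_cone_scaleR[OF C _ x(2)]) simp
      ultimately show False using not_strict unfolding P_def by blast
    qed
    then obtain \<phi> :: "'b dual dual" where
      \<phi>: "0 < blinfun_apply \<phi> \<beta>" "\<And>d. d \<in> D \<Longrightarrow> blinfun_apply \<phi> d \<le> 0"
      using separate_point_convex_cone[OF \<open>convex_cone D\<close>] by blast
    obtain y where "\<And>w. blinfun_apply \<phi> w = blinfun_apply w y"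
      using refl unfolding reflexive_space_def by blast
    with \<phi> have y: "0 < blinfun_apply \<beta> y" "\<And>d. d \<in> D \<Longrightarrow> blinfun_apply d y \<le> 0"
      by simp_all
    have C0: "0 \<in> C" and P0: "0 \<in> P"
      using C P by (simp_all add: convex_cone_contains_0)
    have "y \<in> K"
    proof (rule bipolar_dual_cone[OF K])
      fix k
      assume "k \<in> dual_cone K"
      then show "0 \<le> blinfun_apply k y"
        using y(2)[OF D_mem[OF C0, of k 0]]
        by (simp add: P_def linear_0[OF A] blinfun.bilinear_simps)
    qed
    have b: "0 \<le> blinfun_apply b y"
      using y(2)[OF D_mem[OF C0 P0, of 1]] by (simp add: linear_0[OF A] blinfun.bilinear_simps)
    have Ay: "blinfun_apply (A x) y \<le> 0" if "x \<in> C" for x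
      using y(2)[OF D_mem[OF that P0, of 0]] by simp
    define y' where "y' = (1 / blinfun_apply \<beta> y) *\<^sub>R y"
    have "y' \<in> strategy_set \<beta> K"
      using y(1) \<open>y \<in> K\<close> convex_cone_scaleR[OF K(1)]
      by (simp add: y'_def strategy_set_def blinfun.bilinear_simps)
    moreover have "\<forall>x\<in>C. blinfun_apply (A x) y' \<le> 0"
      using Ay y(1) by (simp add: y'_def blinfun.bilinear_simps divide_nonpos_pos)
    ultimately have "blinfun_apply b y' < 0"
      using alt by blast
    with b y(1) show False
      by (simp add: y'_def blinfun.bilinear_simps divide_less_0_iff)
  qed
qed

section \<open>Strict feasibility of the primal and the dual program\<close>

lemma dual_adjoint_apply:
  assumes "has_dual_adjoint A"
  shows "blinfun_apply (dual_adjoint A y) x = blinfun_apply (A x) y"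
proof -
  from assms have "\<exists>!w. \<forall>x. blinfun_apply w x = blinfun_apply (A x) y"
    unfolding has_dual_adjoint_def by blast
  from theI'[OF this] show ?thesis unfolding dual_adjoint_def by blast
qed

lemma linear_dual_adjoint:
  assumes "has_dual_adjoint A"
  shows "linear (dual_adjoint A)"
  by (rule linearI)
    (auto intro!: blinfun_eqI simp: dual_adjoint_apply[OF assms] blinfun.bilinear_simps)

theorem lemma4p2:
  fixes A :: "'a::banach \<Rightarrow> 'b::banach dual"
    and C :: "'a set" and K :: "'b set"
    and c \<alpha> :: "'a dual" and b \<beta> :: "'b dual"
    and S :: "'a set" and T :: "'b set"
    and v :: real
  assumes "reflexive_space TYPE('a)" and "reflexive_space TYPE('b)"
    and "linear A" and "has_dual_adjoint A"
    and "closed C" and "convex C" and "cone C"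
    and "closed K" and "convex K" and "cone K"
    and "interior (dual_cone C) \<noteq> {}" and "interior (dual_cone K) \<noteq> {}"
    and "primal_feasible_set A b C K \<noteq> {}"
    and "dual_feasible_set A c C K \<noteq> {}"
    and "\<alpha> \<in> interior (dual_cone C)" and "\<beta> \<in> interior (dual_cone K)"
    and "S = strategy_set \<alpha> C" and "T = strategy_set \<beta> K"
    and "admissible_game (\<lambda>x y. blinfun_apply (A x) y) S T"
    and "is_game_value (\<lambda>x y. blinfun_apply (A x) y) S T v"
    and "v = 0"
  shows "(primal_strictly_feasible A b C K \<longleftrightarrow>
            (\<forall>y\<in>T. - dual_adjoint A y \<in> dual_cone C \<longrightarrow> blinfun_apply b y < 0))
       \<and> (dual_strictly_feasible A c C K \<longleftrightarrow>
            (\<forall>x\<in>S. A x \<in> dual_cone K \<longrightarrow> blinfun_apply c x > 0))"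
proof -
  have "C \<noteq> {}" "K \<noteq> {}"
    using assms(13,14) by (auto simp: primal_feasible_set_def dual_feasible_set_def)
  then have C: "convex_cone C" and K: "convex_cone K"
    using assms(6,7,9,10) convex_cone[of C] convex_cone[of K]
    by (auto simp: convex_cone_def conic_def cone_def)
  note adj = dual_adjoint_apply[OF assms(4)]
  have "primal_strictly_feasible A b C K \<longleftrightarrow>
      (\<forall>y\<in>T. - dual_adjoint A y \<in> dual_cone C \<longrightarrow> blinfun_apply b y < 0)"
    using strict_feasibility_alternative[OF assms(2,3) C K assms(8,16), of b]
    by (simp add: primal_strictly_feasible_def assms(18) dual_cone_def[of C] adj
        blinfun.bilinear_simps)
  \<comment> \<open>The second equivalence is the first one for the program over \<open>K\<close> with operator \<open>- A\<^sup>*\<close>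
    and right-hand side \<open>- c\<close>, whose adjoint condition reads \<open>A x \<in> K\<^sup>*\<close>.\<close>
  moreover have "linear (\<lambda>y. - dual_adjoint A y)"
    by (intro linear_compose_neg linear_dual_adjoint assms(4))
  from strict_feasibility_alternative[OF assms(1) this K C assms(5,15), of "- c"]
  have "dual_strictly_feasible A c C K \<longleftrightarrow>
      (\<forall>x\<in>S. A x \<in> dual_cone K \<longrightarrow> blinfun_apply c x > 0)"
    by (simp add: dual_strictly_feasible_def assms(17) dual_cone_def[of K] adj
        blinfun.bilinear_simps)
  ultimately show ?thesis by blast
qed

end
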